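(* Let $G$ be a basic CUH graph. If both $D$ and $\widetilde{D}$ are realized in $G$, then $G$ is piecewise ultrahomogeneous, i.e., for every maximal red clique $M_R$ and every maximal blue clique $M_B$ of $G$, the 2-colored graph $G[M_R\cup M_B]$ is ultrahomogeneous.
   Context: All graphs are simple. A 2-colored graph is a graph $G$ with a map $\chi\colon V(G)\to\{\text{red},\text{blue}\}$; $R$ and $B$ denote the sets of red and blue vertices. Induced subgraphs inherit colors, and isomorphisms/automorphisms of 2-colored graphs are color-preserving graph isomorphisms. $G$ is ultrahomogeneous if every isomorphism between two finite induced subgraphs of $G$ extends to an automorphism of $G$. Cross edges are edges joining vertices of different colors. A CUH graph is a countably infinite ultrahomogeneous 2-colored graph in which $G[R]$ and $G[B]$ are both disjoint unions of cliques. Write $\alpha_R,\alpha_B$ for the independence numbers of $G[R],G[B]$ (values in $\mathbb{N}\cup\{\aleph_0\}$). $G$ is a blow-up if for one of the colors $c$ (the other color being $c'$) there are a 2-colored graph $H$ whose $c$-colored vertices form an independent set and a cardinal $i\in\mathbb{N}_{\ge 2}\cup\{\aleph_0\}$ such that $G$ arises from $H$ by replacing each $c$-colored vertex $u$ by a $c$-colored clique of size $i$, each of whose vertices is adjacent exactly to the other vertices of this clique and to the $c'$-colored neighbors of $u$ in $H$ (the $c'$-colored part and its internal edges unchanged). A CUH graph is basic if it is not a blow-up and $\min\{\alpha_R,\alpha_B\}\ge 2$. A finite 2-colored graph is realized in $G$ if it is isomorphic (color-preservingly) to an induced subgraph of $G$. $D$ is the 2-colored graph on red $r_1,r_2$ and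 blue $b_1,b_2$ with edges $r_1r_2, b_1b_2, r_1b_1, r_1b_2, r_2b_1$ (i.e., all possible edges except $r_2b_2$). $\widetilde{D}$ is the 2-colored graph on red $r_1,r_2$ and blue $b_1,b_2$ with edges $r_1r_2,b_1b_2,r_2b_2$ (obtained from $D$ by complementing the cross edges). *)

theory Defs
  imports Main "HOL-Library.Extended_Nat" "HOL-Library.Countable_Set" "HOL-Library.Disjoint_Sets"
begin

datatype color = Red | Blue

record 'a cgraph =
  verts :: "'a set"
  edges :: "'a set set"
  colr :: "'a \<Rightarrow> color"

text \<open>
  Edges are two-element sets of vertices. Values of \<open>colr G\<close> outside \<open>verts G\<close> are irrelevant.
\<close>

definition two_colored_graph :: "'a cgraph \<Rightarrow> bool" where
  "two_colored_graph G \<longleftrightarrow> edges G \<subseteq> {{u, v} | u v. u \<in> verts G \<and> v \<in> verts G \<and> u \<noteq> v}"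

definition color_class :: "'a cgraph \<Rightarrow> color \<Rightarrow> 'a set" where
  "color_class G c = {v \<in> verts G. colr G v = c}"

definition induced :: "'a cgraph \<Rightarrow> 'a set \<Rightarrow> 'a cgraph" where
  "induced G S = \<lparr>verts = verts G \<inter> S, edges = {e \<in> edges G. e \<subseteq> S}, colr = colr G\<rparr>"

definition cg_iso :: "'a cgraph \<Rightarrow> 'b cgraph \<Rightarrow> ('a \<Rightarrow> 'b) \<Rightarrow> bool" where
  "cg_iso G H f \<longleftrightarrow>
     bij_betw f (verts G) (verts H) \<and>
     (\<forall>u\<in>verts G. \<forall>v\<in>verts G. {u, v} \<in> edges G \<longleftrightarrow> {f u, f v} \<in> edges H) \<and>
     (\<forall>u\<in>verts G. colr H (f u) = colr G u)"

definition isomorphic :: "'a cgraph \<Rightarrow> 'b cgraph \<Rightarrow> bool" where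
  "isomorphic G H \<longleftrightarrow> (\<exists>f. cg_iso G H f)"

abbreviation automorphism :: "'a cgraph \<Rightarrow> ('a \<Rightarrow> 'a) \<Rightarrow> bool" where
  "automorphism G g \<equiv> cg_iso G G g"

definition ultrahomogeneous :: "'a cgraph \<Rightarrow> bool" where
  "ultrahomogeneous G \<longleftrightarrow>
     (\<forall>S T f. S \<subseteq> verts G \<and> T \<subseteq> verts G \<and> finite S \<and> finite T \<and>
        cg_iso (induced G S) (induced G T) f \<longrightarrow>
        (\<exists>g. automorphism G g \<and> (\<forall>u\<in>S. g u = f u)))"

definition disjoint_union_of_cliques :: "'a cgraph \<Rightarrow> bool" where
  "disjoint_union_of_cliques G \<longleftrightarrow>
     (\<exists>P. partition_on (verts G) P \<and>
        (\<forall>u\<in>verts G. \<forall>v\<in>verts G.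
           {u, v} \<in> edges G \<longleftrightarrow> u \<noteq> v \<and> (\<exists>C\<in>P. u \<in> C \<and> v \<in> C)))"

definition CUH :: "'a cgraph \<Rightarrow> bool" where
  "CUH G \<longleftrightarrow>
     two_colored_graph G \<and> countable (verts G) \<and> infinite (verts G) \<and> ultrahomogeneous G \<and>
     (\<forall>c. disjoint_union_of_cliques (induced G (color_class G c)))"

definition independent_set :: "'a cgraph \<Rightarrow> 'a set \<Rightarrow> bool" where
  "independent_set G S \<longleftrightarrow> S \<subseteq> verts G \<and> (\<forall>u\<in>S. \<forall>v\<in>S. {u, v} \<notin> edges G)"

text \<open>
  In cardinalities of countable sets, \<open>\<infinity> :: enat\<close> stands for the cardinal aleph-zero.
\<close>

definition ecard :: "'a set \<Rightarrow> enat" where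
  "ecard S = (if finite S then enat (card S) else \<infinity>)"

definition independence_number :: "'a cgraph \<Rightarrow> enat" where
  "independence_number G = (SUP S\<in>{S. independent_set G S}. ecard S)"

abbreviation alpha :: "'a cgraph \<Rightarrow> color \<Rightarrow> enat" where
  "alpha G c \<equiv> independence_number (induced G (color_class G c))"

text \<open>
  The clique of size \<open>i\<close> replacing a \<open>c\<close>-colored vertex \<open>u\<close> is \<open>{(u, k) | k. enat k < i}\<close>;
  a vertex \<open>u\<close> of the other color is kept as \<open>(u, 0)\<close>.
\<close>

definition blow_up_verts :: "'a cgraph \<Rightarrow> color \<Rightarrow> enat \<Rightarrow> ('a \<times> nat) set" where
  "blow_up_verts H c i =
     {(u, k). u \<in> verts H \<and> (if colr H u = c then enat k < i else k = 0)}"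

definition blow_up :: "'a cgraph \<Rightarrow> color \<Rightarrow> enat \<Rightarrow> ('a \<times> nat) cgraph" where
  "blow_up H c i =
     \<lparr>verts = blow_up_verts H c i,
      edges = {{(u, k), (v, l)} | u k v l.
                 (u, k) \<in> blow_up_verts H c i \<and> (v, l) \<in> blow_up_verts H c i \<and>
                 ({u, v} \<in> edges H \<or> u = v \<and> k \<noteq> l)},
      colr = (\<lambda>(u, k). colr H u)\<rparr>"

text \<open>
  Taking \<open>H\<close> over the vertex type of \<open>G\<close> loses no generality: if \<open>G\<close> arises from \<open>H\<close>,
  then \<open>H\<close> is isomorphic to an induced subgraph of \<open>G\<close>.
\<close>

definition is_blow_up :: "'a cgraph \<Rightarrow> bool" where
  "is_blow_up G \<longleftrightarrow>
     (\<exists>c (H :: 'a cgraph) i. two_colored_graph H \<and> independent_set H (color_class H c) \<and>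
        2 \<le> i \<and> isomorphic G (blow_up H c i))"

definition basic_CUH :: "'a cgraph \<Rightarrow> bool" where
  "basic_CUH G \<longleftrightarrow> CUH G \<and> \<not> is_blow_up G \<and> min (alpha G Red) (alpha G Blue) \<ge> 2"

definition realized :: "'b cgraph \<Rightarrow> 'a cgraph \<Rightarrow> bool" where
  "realized F G \<longleftrightarrow> (\<exists>S \<subseteq> verts G. isomorphic F (induced G S))"

datatype dvert = vr1 | vr2 | vb1 | vb2

primrec dvert_color :: "dvert \<Rightarrow> color" where
  "dvert_color vr1 = Red"
| "dvert_color vr2 = Red"
| "dvert_color vb1 = Blue"
| "dvert_color vb2 = Blue"

definition D_graph :: "dvert cgraph" where
  "D_graph = \<lparr>verts = {vr1, vr2, vb1, vb2},
     edges = {{vr1, vr2}, {vb1, vb2}, {vr1, vb1}, {vr1, vb2}, {vr2, vb1}}, colr = dvert_color\<rparr>"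

definition D_tilde_graph :: "dvert cgraph" where
  "D_tilde_graph = \<lparr>verts = {vr1, vr2, vb1, vb2},
     edges = {{vr1, vr2}, {vb1, vb2}, {vr2, vb2}}, colr = dvert_color\<rparr>"

lemma two_colored_graphI:
  assumes "\<And>e. e \<in> edges G \<Longrightarrow> \<exists>u v. e = {u, v} \<and> u \<in> verts G \<and> v \<in> verts G \<and> u \<noteq> v"
  shows "two_colored_graph G"
  unfolding two_colored_graph_def using assms by blast

lemma two_colored_graph_D: "two_colored_graph D_graph"
  by (rule two_colored_graphI, unfold D_graph_def, simp, elim disjE)
    (use dvert.distinct in metis)+

lemma two_colored_graph_D_tilde: "two_colored_graph D_tilde_graph"
  by (rule two_colored_graphI, unfold D_tilde_graph_def, simp, elim disjE)
    (use dvert.distinct in metis)+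

lemma D_tilde_complements_cross_edges:
  assumes "u \<noteq> v"
  shows "{u, v} \<in> edges D_tilde_graph \<longleftrightarrow>
    (if dvert_color u = dvert_color v then {u, v} \<in> edges D_graph else {u, v} \<notin> edges D_graph)"
  using assms unfolding D_graph_def D_tilde_graph_def
  by (cases u; cases v; simp add: doubleton_eq_iff)

lemma two_colored_graph_induced:
  assumes "two_colored_graph G"
  shows "two_colored_graph (induced G S)"
proof (rule two_colored_graphI)
  fix e assume "e \<in> edges (induced G S)"
  then have "e \<in> edges G" "e \<subseteq> S"
    by (simp_all add: induced_def)
  moreover from this assms obtain u v where "e = {u, v}" "u \<in> verts G" "v \<in> verts G" "u \<noteq> v"
    unfolding two_colored_graph_def by blast
  ultimately show "\<exists>u v. e = {u, v} \<and> u \<in> verts (induced G S) \<and> v \<in> verts (induced G S) \<and> u \<noteq> v"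
    by (auto simp: induced_def)
qed

lemma two_colored_graph_blow_up:
  assumes "two_colored_graph H"
  shows "two_colored_graph (blow_up H c i)"
proof (rule two_colored_graphI)
  fix e assume "e \<in> edges (blow_up H c i)"
  then obtain u k v l where e: "e = {(u, k), (v, l)}"
    and uv: "(u, k) \<in> blow_up_verts H c i" "(v, l) \<in> blow_up_verts H c i"
    and adj: "{u, v} \<in> edges H \<or> u = v \<and> k \<noteq> l"
    by (auto simp: blow_up_def)
  have "{w} \<notin> edges H" for w
    using assms unfolding two_colored_graph_def by (auto simp: doubleton_eq_iff)
  with adj have "(u, k) \<noteq> (v, l)"
    by auto
  with e uv show "\<exists>x y. e = {x, y} \<and> x \<in> verts (blow_up H c i) \<and> y \<in> verts (blow_up H c i) \<and> x \<noteq> y"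
    unfolding blow_up_def by (intro exI[of _ "(u, k)"] exI[of _ "(v, l)"]) simp
qed

definition clique :: "'a cgraph \<Rightarrow> 'a set \<Rightarrow> bool" where
  "clique G M \<longleftrightarrow> M \<subseteq> verts G \<and> (\<forall>u\<in>M. \<forall>v\<in>M. u \<noteq> v \<longrightarrow> {u, v} \<in> edges G)"

definition colored_clique :: "'a cgraph \<Rightarrow> color \<Rightarrow> 'a set \<Rightarrow> bool" where
  "colored_clique G c M \<longleftrightarrow> clique G M \<and> M \<subseteq> color_class G c"

definition maximal_colored_clique :: "'a cgraph \<Rightarrow> color \<Rightarrow> 'a set \<Rightarrow> bool" where
  "maximal_colored_clique G c M \<longleftrightarrow>
     colored_clique G c M \<and> (\<forall>M'. colored_clique G c M' \<and> M \<subseteq> M' \<longrightarrow> M' = M)"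

definition piecewise_ultrahomogeneous :: "'a cgraph \<Rightarrow> bool" where
  "piecewise_ultrahomogeneous G \<longleftrightarrow>
     (\<forall>M\<^sub>R M\<^sub>B. maximal_colored_clique G Red M\<^sub>R \<and> maximal_colored_clique G Blue M\<^sub>B \<longrightarrow>
        ultrahomogeneous (induced G (M\<^sub>R \<union> M\<^sub>B)))"

end

theory Submission
  imports Defs "HOL-Combinatorics.Permutations"
begin

text \<open>
  Fix a red clique \<open>M\<close> and a blue clique \<open>M'\<close>, both maximal. A partial isomorphism of
  \<open>G[M \<union> M']\<close> whose domain meets both cliques extends to an automorphism of \<open>G\<close> that stabilizes
  both of them, so only a bijection \<open>f : S \<rightarrow> T\<close> between finite subsets of one clique, say \<open>M\<close>, is
  critical. It suffices to find \<open>b, b' \<in> M'\<close> such that \<open>f \<union> {b \<mapsto> b'}\<close> is still a partial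
  isomorphism, and for this that every permutation of \<open>W = S \<union> T\<close> permutes the set of traces
  \<open>N(b) \<inter> W\<close>, \<open>b \<in> M'\<close>. For a transposition \<open>(x y)\<close> this is immediate from ultrahomogeneity
  if some \<open>b \<in> M'\<close> does not distinguish \<open>x\<close> and \<open>y\<close>. Realization of \<open>D\<close> implies that for
  all distinct \<open>x, y \<in> M\<close> some \<open>b \<in> M'\<close> is adjacent to \<open>x\<close> but not to \<open>y\<close>. Hence if all of \<open>M'\<close>
  distinguishes \<open>x\<close> and \<open>y\<close>, then for each third \<open>z \<in> W\<close> neither \<open>x, z\<close> nor \<open>y, z\<close> is
  distinguished by all of \<open>M'\<close>, and \<open>(x y) = (x z)(y z)(x z)\<close>.
\<close>

section \<open>Adjacency, and extension of finite partial isomorphisms\<close>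

abbreviation adj :: "'a cgraph \<Rightarrow> 'a \<Rightarrow> 'a \<Rightarrow> bool" where
  "adj G u v \<equiv> {u, v} \<in> edges G"

lemma adj_irrefl: "two_colored_graph G \<Longrightarrow> \<not> adj G u u"
  unfolding two_colored_graph_def by (auto simp: doubleton_eq_iff)

lemma adj_commute: "adj G u v \<longleftrightarrow> adj G v u"
  by (simp add: insert_commute)

lemma verts_induced [simp]: "verts (induced G S) = verts G \<inter> S"
  by (simp add: induced_def)

lemma adj_induced [simp]: "adj (induced G S) u v \<longleftrightarrow> adj G u v \<and> u \<in> S \<and> v \<in> S"
  by (auto simp: induced_def)

lemma colr_induced [simp]: "colr (induced G S) = colr G"
  by (simp add: induced_def)

lemma ultrahomogeneous_extend:
  assumes "ultrahomogeneous G" "finite S" "S \<subseteq> verts G" "f ` S \<subseteq> verts G" "inj_on f S"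
    and "\<And>u v. u \<in> S \<Longrightarrow> v \<in> S \<Longrightarrow> adj G u v \<longleftrightarrow> adj G (f u) (f v)"
    and "\<And>u. u \<in> S \<Longrightarrow> colr G (f u) = colr G u"
  obtains g where "automorphism G g" "\<And>u. u \<in> S \<Longrightarrow> g u = f u"
proof -
  have "verts G \<inter> S = S" "verts G \<inter> f ` S = f ` S"
    using assms(3,4) by auto
  then have "cg_iso (induced G S) (induced G (f ` S)) f"
    using assms(5,7) by (auto simp: cg_iso_def bij_betw_def assms(6)[symmetric])
  moreover have "finite (f ` S)"
    using assms(2) by simp
  ultimately obtain g where "automorphism G g" "\<forall>u\<in>S. g u = f u"
    using assms(1-4) unfolding ultrahomogeneous_def by meson
  then show thesis
    using that by blast
qed

lemma automorphism_simps:
  assumes "automorphism G g" "u \<in> verts G"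
  shows "g u \<in> verts G" "colr G (g u) = colr G u"
    and "v \<in> verts G \<Longrightarrow> adj G (g u) (g v) \<longleftrightarrow> adj G u v"
    and "v \<in> verts G \<Longrightarrow> g u = g v \<longleftrightarrow> u = v"
  using assms unfolding cg_iso_def bij_betw_def inj_on_def by auto

section \<open>Maximal monochromatic cliques and the automorphisms that stabilize them\<close>

lemma same_color_adj_trans:
  assumes "disjoint_union_of_cliques (induced G (color_class G c))"
    and "u \<in> color_class G c" "v \<in> color_class G c" "w \<in> color_class G c"
    and "adj G u v" "adj G v w" "u \<noteq> w"
  shows "adj G u w"
proof -
  obtain P where P: "partition_on (verts (induced G (color_class G c))) P"
    and e: "\<forall>u\<in>verts (induced G (color_class G c)). \<forall>v\<in>verts (induced G (color_class G c)).
      adj (induced G (color_class G c)) u v \<longleftrightarrow> u \<noteq> v \<and> (\<exists>C\<in>P. u \<in> C \<and> v \<in> C)"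
    using assms(1) unfolding disjoint_union_of_cliques_def by blast
  have v: "x \<in> verts (induced G (color_class G c))" if "x \<in> color_class G c" for x
    using that by (simp add: color_class_def)
  have e': "adj G x y \<longleftrightarrow> x \<noteq> y \<and> (\<exists>C\<in>P. x \<in> C \<and> y \<in> C)"
    if "x \<in> color_class G c" "y \<in> color_class G c" for x y
    using e v that by auto
  obtain C C' where C: "C \<in> P" "u \<in> C" "v \<in> C" "C' \<in> P" "v \<in> C'" "w \<in> C'"
    using e'[OF assms(2,3)] e'[OF assms(3,4)] assms(5,6) by auto
  then have "C = C'"
    using P unfolding partition_on_def disjoint_def by blast
  then show ?thesis
    using C e'[OF assms(2,4)] assms(7) by auto
qed

text \<open>Adjacency within one color is transitive, so a neighbor of \<open>u\<close> in that
  color is adjacent to all other vertices of \<open>M\<close> and maximality absorbs it. Thus any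
  one vertex determines its maximal clique.\<close>

lemma maximal_colored_clique_iff:
  assumes "disjoint_union_of_cliques (induced G (color_class G c))"
    and M: "maximal_colored_clique G c M" "u \<in> M"
  shows "v \<in> M \<longleftrightarrow> v \<in> color_class G c \<and> (v = u \<or> adj G u v)"
proof -
  have clique: "\<And>x y. x \<in> M \<Longrightarrow> y \<in> M \<Longrightarrow> x \<noteq> y \<Longrightarrow> adj G x y" and color: "M \<subseteq> color_class G c"
    and max: "\<And>M'. colored_clique G c M' \<Longrightarrow> M \<subseteq> M' \<Longrightarrow> M' = M"
    using M(1) by (simp_all add: maximal_colored_clique_def colored_clique_def clique_def)
  have "v \<in> M" if v: "v \<in> color_class G c" "adj G u v" "v \<noteq> u"
  proof -
    have vw: "adj G v w" if "w \<in> M" "v \<noteq> w" for w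
    proof (cases "w = u")
      case True
      then show ?thesis
        using v adj_commute by metis
    next
      case False
      then have "adj G u w" "adj G v u"
        using clique[OF M(2) that(1)] v(2) adj_commute by metis+
      then show ?thesis
        using same_color_adj_trans[OF assms(1) v(1) _ _ _ _ that(2)] color M(2) that(1) by blast
    qed
    moreover have "adj G w v" if "w \<in> M" "v \<noteq> w" for w
      using vw[OF that] adj_commute by metis
    ultimately have "colored_clique G c (insert v M)"
      using clique color v(1) by (auto simp: colored_clique_def clique_def color_class_def)
    then show ?thesis
      using max by blast
  qed
  then show ?thesis
    using clique[OF M(2)] color M(2) by blast
qed

text \<open>Since \<open>M\<close> is determined by any of its vertices, a single vertex of
  \<open>M\<close> with image in \<open>M\<close> anchors the whole clique. This is how extensions
  to all of \<open>G\<close> are later cut down to a pair of cliques.\<close>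

lemma automorphism_maximal_colored_clique:
  assumes "disjoint_union_of_cliques (induced G (color_class G c))"
    and "maximal_colored_clique G c M" "automorphism G g" "u \<in> M" "g u \<in> M" "v \<in> verts G"
  shows "g v \<in> M \<longleftrightarrow> v \<in> M"
proof -
  have u: "u \<in> color_class G c"
    using maximal_colored_clique_iff[OF assms(1,2,4)] assms(4) by blast
  then have "u \<in> verts G"
    by (simp add: color_class_def)
  then show ?thesis
    using maximal_colored_clique_iff[OF assms(1,2,4), of v]
      maximal_colored_clique_iff[OF assms(1,2,5), of "g v"] assms(6)
      automorphism_simps(3)[OF assms(3), of u v] automorphism_simps(4)[OF assms(3), of v u]
      automorphism_simps(1,2)[OF assms(3,6)]
    by (simp add: color_class_def)
qed

lemma maximal_colored_clique_nonempty:
  assumes "maximal_colored_clique G c M" "v \<in> color_class G c"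
  shows "M \<noteq> {}"
proof
  assume "M = {}"
  moreover have "colored_clique G c {v}"
    using assms(2) by (auto simp: colored_clique_def clique_def color_class_def)
  ultimately show False
    using assms(1) unfolding maximal_colored_clique_def by blast
qed

lemma automorphism_induced:
  assumes "automorphism G g" "M \<subseteq> verts G" "\<And>v. v \<in> verts G \<Longrightarrow> g v \<in> M \<longleftrightarrow> v \<in> M"
  shows "automorphism (induced G M) g"
proof -
  have "g ` verts G = verts G" "inj_on g (verts G)"
    using assms(1) by (auto simp: cg_iso_def bij_betw_def)
  \<comment> \<open>\<open>M\<close> may be infinite, so injectivity alone does not give
    surjectivity; preimages exist in \<open>verts G\<close> and lie in \<open>M\<close> by the
    equivalence.\<close>
  moreover have "g ` M = M"
  proof (intro equalityI subsetI)
    fix y assume "y \<in> M"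
    then obtain x where "x \<in> verts G" "y = g x"
      using assms(2) \<open>g ` verts G = verts G\<close> by blast
    then show "y \<in> g ` M"
      using \<open>y \<in> M\<close> assms(3) by blast
  qed (use assms(2,3) in blast)
  ultimately have "bij_betw g M M"
    using assms(2) by (auto simp: bij_betw_def intro: inj_on_subset)
  moreover have "verts G \<inter> M = M"
    using assms(2) by auto
  ultimately show ?thesis
    using assms(1,2) bij_betwE[of g M M] by (simp add: cg_iso_def subset_iff)
qed

text \<open>\<open>S\<close> and \<open>T\<close> have equal finite size, hence so do their
  complements in \<open>S \<union> T\<close>; any bijection \<open>h\<close> between these completes
  \<open>f\<close>.\<close>

lemma bij_betw_extend_permutes:
  assumes "bij_betw f S T" "finite S"
  obtains p where "p permutes S \<union> T" "\<And>x. x \<in> S \<Longrightarrow> p x = f x"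
proof -
  have fin: "finite T" "card S = card T"
    using assms bij_betw_finite bij_betw_same_card by blast+
  have "card (S \<union> T - S) = card (S \<union> T - T)"
    using assms fin by (simp add: card_Diff_subset)
  then obtain h where h: "bij_betw h (S \<union> T - S) (S \<union> T - T)"
    using assms fin by (meson finite_Diff finite_Un finite_same_card_bij)
  define p where "p x = (if x \<in> S then f x else if x \<in> T then h x else x)" for x
  have "bij_betw p S T"
    using assms(1) by (subst bij_betw_cong[of _ _ f]) (auto simp: p_def)
  moreover have "bij_betw p (S \<union> T - S) (S \<union> T - T)"
    using h by (subst bij_betw_cong[of _ _ h]) (auto simp: p_def)
  ultimately have "bij_betw p (S \<union> (S \<union> T - S)) (T \<union> (S \<union> T - T))"
    by (rule bij_betw_combine) auto
  moreover have "S \<union> (S \<union> T - S) = S \<union> T" "T \<union> (S \<union> T - T) = S \<union> T"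
    by auto
  ultimately have "p permutes S \<union> T"
    by (intro bij_imp_permutes) (auto simp: p_def)
  then show thesis
    by (rule that) (simp add: p_def)
qed

section \<open>Copies of the pattern D\<close>

definition contains_D :: "'a cgraph \<Rightarrow> color \<Rightarrow> color \<Rightarrow> bool" where
  "contains_D G c c' \<longleftrightarrow>
     (\<exists>r1\<in>color_class G c. \<exists>r2\<in>color_class G c. \<exists>b1\<in>color_class G c'. \<exists>b2\<in>color_class G c'.
        adj G r1 r2 \<and> adj G b1 b2 \<and> adj G r1 b1 \<and> adj G r1 b2 \<and> adj G r2 b1 \<and> \<not> adj G r2 b2)"

text \<open>D is symmetric: exchanging each red vertex with the blue vertex of the same index
  preserves its edge set.\<close>

lemma contains_D_commute:
  assumes "contains_D G c c'"
  shows "contains_D G c' c"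
proof -
  obtain r1 r2 b1 b2 where D: "r1 \<in> color_class G c" "r2 \<in> color_class G c"
    "b1 \<in> color_class G c'" "b2 \<in> color_class G c'"
    "adj G r1 r2" "adj G b1 b2" "adj G r1 b1" "adj G r1 b2" "adj G r2 b1" "\<not> adj G r2 b2"
    using assms unfolding contains_D_def by blast
  show ?thesis
    unfolding contains_D_def
    by (rule bexI[OF _ D(3)], rule bexI[OF _ D(4)], rule bexI[OF _ D(1)], rule bexI[OF _ D(2)])
      (use D(5-) in \<open>simp add: insert_commute\<close>)
qed

lemma realized_D_contains_D:
  assumes "realized D_graph G"
  shows "contains_D G Red Blue"
proof -
  obtain S f where "S \<subseteq> verts G" and f: "cg_iso D_graph (induced G S) f"
    using assms unfolding realized_def isomorphic_def by blast
  have UNIV: "v \<in> verts D_graph" for v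
    by (cases v) (simp_all add: D_graph_def)
  have bij: "bij_betw f (verts D_graph) (verts G \<inter> S)"
    and col: "\<forall>v\<in>verts D_graph. colr G (f v) = colr D_graph v"
    and adj: "\<forall>u\<in>verts D_graph. \<forall>v\<in>verts D_graph.
      adj D_graph u v \<longleftrightarrow> adj (induced G S) (f u) (f v)"
    using f unfolding cg_iso_def by simp_all
  have V: "f v \<in> verts G \<inter> S" for v
    using bij_betw_apply[OF bij UNIV] .
  have E: "adj G (f u) (f v) \<longleftrightarrow> adj D_graph u v" for u v
    using adj UNIV V by (metis IntD2 adj_induced)
  have C: "f v \<in> color_class G (dvert_color v)" for v
    using V bspec[OF col UNIV] by (simp add: color_class_def D_graph_def)
  show ?thesis
    unfolding contains_D_def
    using C[of vr1] C[of vr2] C[of vb1] C[of vb2]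
    by (intro bexI[of _ "f vr1"] bexI[of _ "f vr2"] bexI[of _ "f vb1"] bexI[of _ "f vb2"])
      (simp_all add: E, simp add: D_graph_def doubleton_eq_iff)
qed

section \<open>Vertices of one clique separated by the other\<close>

locale D_clique_pair =
  fixes G :: "'a cgraph" and c c' :: color and M M' :: "'a set"
  assumes graph: "two_colored_graph G"
    and uh: "ultrahomogeneous G"
    and cliques: "\<And>d. disjoint_union_of_cliques (induced G (color_class G d))"
    and colors: "c \<noteq> c'"
    and M: "maximal_colored_clique G c M"
    and M': "maximal_colored_clique G c' M'"
    and D: "contains_D G c c'"
begin

lemma M_color: "x \<in> M \<Longrightarrow> x \<in> verts G \<and> colr G x = c"
  and M'_color: "x \<in> M' \<Longrightarrow> x \<in> verts G \<and> colr G x = c'"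
  using M M' by (auto simp: maximal_colored_clique_def colored_clique_def color_class_def)

lemma M_adj: "x \<in> M \<Longrightarrow> y \<in> M \<Longrightarrow> adj G x y \<longleftrightarrow> x \<noteq> y"
  using M adj_irrefl[OF graph] by (auto simp: maximal_colored_clique_def colored_clique_def clique_def)

lemma M'_nonempty: "M' \<noteq> {}"
  using D maximal_colored_clique_nonempty[OF M'] unfolding contains_D_def by blast

lemma automorphism_M':
  "automorphism G g \<Longrightarrow> b \<in> M' \<Longrightarrow> g b \<in> M' \<Longrightarrow> v \<in> verts G \<Longrightarrow> g v \<in> M' \<longleftrightarrow> v \<in> M'"
  using automorphism_maximal_colored_clique[OF cliques M'] by blast

lemma neighbor_closed_M':
  "b \<in> M' \<Longrightarrow> v \<in> color_class G c' \<Longrightarrow> adj G b v \<Longrightarrow> v \<in> M'"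
  using maximal_colored_clique_iff[OF cliques M'] by blast

text \<open>Let \<open>b \<in> M'\<close> be a non-neighbor of \<open>x\<close>. The non-adjacent
  cross pair of D can be moved to \<open>x, b\<close>; the remaining blue vertex of D is adjacent to
  both members of that pair, so its image is a neighbor of \<open>x\<close> and lies in
  \<open>M'\<close>.\<close>

lemma ex_neighbor:
  assumes x: "x \<in> M"
  obtains b where "b \<in> M'" "adj G x b"
proof -
  obtain r b1 b2 where r: "r \<in> color_class G c" and b: "b1 \<in> color_class G c'" "b2 \<in> color_class G c'"
    and e: "adj G b1 b2" "adj G r b1" "\<not> adj G r b2"
    using D unfolding contains_D_def by blast
  obtain b where b': "b \<in> M'"
    using M'_nonempty by blast
  show thesis
  proof (cases "adj G x b")
    case False
    have ne: "r \<noteq> b2" "x \<noteq> b"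
      using r b colors M_color[OF x] M'_color[OF b'] by (auto simp: color_class_def)
    define f where "f v = (if v = r then x else b)" for v
    have fe: "\<And>u v. u \<in> {r, b2} \<Longrightarrow> v \<in> {r, b2} \<Longrightarrow> adj G u v \<longleftrightarrow> adj G (f u) (f v)"
      using False e adj_irrefl[OF graph] ne by (auto simp: f_def adj_commute)
    have finite: "finite {r, b2}"
      by simp
    have fs: "{r, b2} \<subseteq> verts G" "f ` {r, b2} \<subseteq> verts G" "inj_on f {r, b2}"
      "\<And>u. u \<in> {r, b2} \<Longrightarrow> colr G (f u) = colr G u"
      using r b ne M_color[OF x] M'_color[OF b'] by (auto simp: f_def color_class_def)
    obtain g where g: "automorphism G g" "\<And>u. u \<in> {r, b2} \<Longrightarrow> g u = f u"
      using ultrahomogeneous_extend[OF uh finite fs(1-3) fe fs(4)] by blast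
    have gv: "g r = x" "g b2 = b"
      using g(2) ne by (auto simp: f_def)
    have v: "r \<in> verts G" "b1 \<in> verts G" "b2 \<in> verts G"
      using r b by (auto simp: color_class_def)
    have "adj G x (g b1)" "adj G b (g b1)"
      using automorphism_simps(3)[OF g(1) v(1) v(2)] automorphism_simps(3)[OF g(1) v(3) v(2)] e gv
      by (auto simp: adj_commute)
    moreover have "g b1 \<in> color_class G c'"
      using automorphism_simps[OF g(1) v(2)] b by (simp add: color_class_def)
    ultimately show thesis
      using neighbor_closed_M'[OF b'] that by blast
  qed (use b' that in blast)
qed

text \<open>Take a neighbor \<open>b\<close> of \<open>x\<close>. If it is also adjacent to
  \<open>y\<close>, then \<open>x, y, b\<close> looks like \<open>r1, r2, b1\<close> in D, and an
  automorphism realizing this carries \<open>b2\<close> to the required vertex, which is in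
  \<open>M'\<close> as a neighbor of \<open>b\<close>.\<close>

lemma ex_separating:
  assumes x: "x \<in> M" and y: "y \<in> M" and xy: "x \<noteq> y"
  obtains b where "b \<in> M'" "adj G x b" "\<not> adj G y b"
proof -
  obtain b where b: "b \<in> M'" "adj G x b"
    using ex_neighbor[OF x] .
  show thesis
  proof (cases "adj G y b")
    case True
    obtain r1 r2 b1 b2 where r: "r1 \<in> color_class G c" "r2 \<in> color_class G c"
      and bc: "b1 \<in> color_class G c'" "b2 \<in> color_class G c'"
      and e: "adj G r1 r2" "adj G b1 b2" "adj G r1 b1" "adj G r1 b2" "adj G r2 b1" "\<not> adj G r2 b2"
      using D unfolding contains_D_def by blast
    have ne: "r1 \<noteq> r2" "r1 \<noteq> b1" "r2 \<noteq> b1" "x \<noteq> b" "y \<noteq> b"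
      using r bc colors M_color[OF x] M_color[OF y] M'_color[OF b(1)] e adj_irrefl[OF graph]
      by (auto simp: color_class_def)
    define f where "f v = (if v = r1 then x else if v = r2 then y else b)" for v
    have fe: "\<And>u v. u \<in> {r1, r2, b1} \<Longrightarrow> v \<in> {r1, r2, b1} \<Longrightarrow> adj G u v \<longleftrightarrow> adj G (f u) (f v)"
      using True b e adj_irrefl[OF graph] ne M_adj[OF x y] xy by (auto simp: f_def adj_commute)
    have finite: "finite {r1, r2, b1}"
      by simp
    have fs: "{r1, r2, b1} \<subseteq> verts G" "f ` {r1, r2, b1} \<subseteq> verts G" "inj_on f {r1, r2, b1}"
      "\<And>u. u \<in> {r1, r2, b1} \<Longrightarrow> colr G (f u) = colr G u"
      using r bc ne xy M_color[OF x] M_color[OF y] M'_color[OF b(1)]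
      by (auto simp: f_def color_class_def)
    obtain g where g: "automorphism G g" "\<And>u. u \<in> {r1, r2, b1} \<Longrightarrow> g u = f u"
      using ultrahomogeneous_extend[OF uh finite fs(1-3) fe fs(4)] by blast
    have gv: "g r1 = x" "g r2 = y" "g b1 = b"
      using g(2) ne by (auto simp: f_def)
    have v: "r1 \<in> verts G" "r2 \<in> verts G" "b1 \<in> verts G" "b2 \<in> verts G"
      using r bc by (auto simp: color_class_def)
    have "adj G x (g b2)" "\<not> adj G y (g b2)" "adj G b (g b2)"
      using automorphism_simps(3)[OF g(1) v(1) v(4)] automorphism_simps(3)[OF g(1) v(2) v(4)]
        automorphism_simps(3)[OF g(1) v(3) v(4)] e gv
      by auto
    moreover have "g b2 \<in> color_class G c'"
      using automorphism_simps[OF g(1) v(4)] bc by (simp add: color_class_def)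
    ultimately show thesis
      using neighbor_closed_M'[OF b(1)] that by blast
  qed (use b that in blast)
qed

section \<open>Permutations acting on traces\<close>

text \<open>Says that \<open>p\<close> sends traces on \<open>W\<close> to traces. If
  \<open>p\<close> permutes a finite \<open>W\<close>, it acts injectively on the finitely many
  traces and hence permutes them.\<close>

definition preserves_traces :: "'a set \<Rightarrow> ('a \<Rightarrow> 'a) \<Rightarrow> bool" where
  "preserves_traces W p \<longleftrightarrow>
     (\<forall>b\<in>M'. \<exists>b'\<in>M'. \<forall>w\<in>W. adj G b' (p w) \<longleftrightarrow> adj G b w)"

lemma preserves_traces_comp:
  assumes "preserves_traces W p" "preserves_traces W q" "p ` W \<subseteq> W"
  shows "preserves_traces W (q \<circ> p)"
  using assms unfolding preserves_traces_def image_subset_iff comp_def by metis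

text \<open>The transposition fixes \<open>b0\<close> and is a partial isomorphism on
  \<open>insert b0 W\<close>. Its extension to \<open>G\<close> fixes \<open>b0\<close>, hence
  stabilizes \<open>M'\<close> and carries traces to traces.\<close>

lemma preserves_traces_transpose_aux:
  assumes W: "finite W" "W \<subseteq> M" and xy: "x \<in> W" "y \<in> W"
    and b0: "b0 \<in> M'" "adj G b0 x \<longleftrightarrow> adj G b0 y"
  shows "preserves_traces W (transpose x y)"
proof -
  let ?t = "transpose x y"
  have W_color: "w \<in> verts G \<and> colr G w = c" if "w \<in> W" for w
    using that W M_color by blast
  have ne: "b0 \<notin> W" and tb: "?t b0 = b0"
    using W_color M'_color[OF b0(1)] colors xy by (auto simp: transpose_def)
  have tW: "?t w \<in> W" if "w \<in> W" for w
    using that xy by (auto simp: transpose_def)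
  have b0w: "adj G b0 (?t w) \<longleftrightarrow> adj G b0 w" for w
    using b0(2) by (auto simp: transpose_def)
  \<comment> \<open>Inside the clique \<open>M\<close> adjacency is just inequality, which every
    injection preserves.\<close>
  have tM: "adj G (?t u) (?t v) \<longleftrightarrow> adj G u v" if "u \<in> W" "v \<in> W" for u v
  proof -
    have "?t u = ?t v \<longleftrightarrow> u = v"
      by (metis transpose_involutory)
    moreover have "u \<in> M" "v \<in> M" "?t u \<in> M" "?t v \<in> M"
      using that tW W(2) by auto
    ultimately show ?thesis
      by (simp add: M_adj)
  qed
  have te: "adj G u v \<longleftrightarrow> adj G (?t u) (?t v)" if "u \<in> insert b0 W" "v \<in> insert b0 W" for u v
  proof (cases "u = b0")
    case True
    then show ?thesis
      by (simp add: tb b0w)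
  next
    case False
    then show ?thesis
      using that by (cases "v = b0") (simp_all add: tb tM b0w adj_commute[where v = b0])
  qed
  have ts: "insert b0 W \<subseteq> verts G" "?t ` insert b0 W \<subseteq> verts G"
    using W_color tW tb M'_color[OF b0(1)] by auto
  have tc: "colr G (?t u) = colr G u" if "u \<in> insert b0 W" for u
    using that W_color tW tb by auto
  have ti: "finite (insert b0 W)" "inj_on ?t (insert b0 W)"
    using W(1) by (simp, metis inj_onI transpose_involutory)
  obtain g where g: "automorphism G g" "\<And>u. u \<in> insert b0 W \<Longrightarrow> g u = ?t u"
    using ultrahomogeneous_extend[OF uh ti(1) ts ti(2) te tc] by blast
  have "g b0 \<in> M'"
    using g(2) tb b0(1) by simp
  show ?thesis
    unfolding preserves_traces_def
  proof
    fix b assume b: "b \<in> M'"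
    have "g b \<in> M'"
      using automorphism_M'[OF g(1) b0(1) \<open>g b0 \<in> M'\<close>] b M'_color by blast
    moreover have "adj G (g b) (?t w) \<longleftrightarrow> adj G b w" if "w \<in> W" for w
      using automorphism_simps(3)[OF g(1), of b w] g(2)[of w] that W_color M'_color[OF b] by auto
    ultimately show "\<exists>b'\<in>M'. \<forall>w\<in>W. adj G b' (?t w) \<longleftrightarrow> adj G b w"
      by blast
  qed
qed

lemma preserves_traces_transpose:
  assumes W: "finite W" "W \<subseteq> M" and xy: "x \<in> W" "y \<in> W"
  shows "preserves_traces W (transpose x y)"
proof (cases "x \<noteq> y \<and> (\<forall>b\<in>M'. adj G b x \<longleftrightarrow> \<not> adj G b y)")
  \<comment> \<open>Either some vertex of \<open>M'\<close> fails to distinguish \<open>x\<close>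
    and \<open>y\<close>, or \<open>x = y\<close> and any vertex of \<open>M'\<close> serves as
    \<open>b0\<close>.\<close>
  case False
  then show ?thesis
    using preserves_traces_transpose_aux[OF W xy] M'_nonempty by (metis all_not_in_conv)
next
  case sep: True
  show ?thesis
  proof (cases "W = {x, y}")
    \<comment> \<open>With no third vertex available, the only traces are the two singletons; both
      occur by separation, and the transposition swaps them.\<close>
    case True
    have mem: "x \<in> M" "y \<in> M"
      using W xy by auto
    obtain b1 where b1: "b1 \<in> M'" "adj G x b1" "\<not> adj G y b1"
      using ex_separating[OF mem] sep by blast
    obtain b2 where b2: "b2 \<in> M'" "adj G y b2" "\<not> adj G x b2"
      using ex_separating[OF mem(2,1)] sep by blast
    show ?thesis
      unfolding preserves_traces_def
    proof
      fix b assume "b \<in> M'"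
      then have b: "adj G b y \<longleftrightarrow> \<not> adj G b x"
        using sep by blast
      define b' where "b' = (if adj G b x then b2 else b1)"
      have "b' \<in> M'" "adj G b' y \<longleftrightarrow> adj G b x" "adj G b' x \<longleftrightarrow> adj G b y"
        using b1 b2 b by (simp_all add: b'_def adj_commute[where v = x] adj_commute[where v = y])
      then show "\<exists>b'\<in>M'. \<forall>w\<in>W. adj G b' (transpose x y w) \<longleftrightarrow> adj G b w"
        using True by (intro bexI[of _ b']) simp_all
    qed
  next
    case False
    then obtain z where z: "z \<in> W" "z \<noteq> x" "z \<noteq> y"
      using xy by blast
    have mem: "x \<in> M" "y \<in> M" "z \<in> M"
      using W xy z by auto
    \<comment> \<open>As \<open>b\<close> distinguishes \<open>x\<close> from \<open>y\<close>, it
      is not adjacent to \<open>x\<close>; so it is adjacent to neither \<open>x\<close> nor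
      \<open>z\<close>. The next choice of \<open>b\<close> treats \<open>y\<close> and
      \<open>z\<close> in the same way.\<close>
    obtain b where b: "b \<in> M'" "adj G y b" "\<not> adj G z b"
      using ex_separating[OF mem(2,3)] z by blast
    have "adj G b x \<longleftrightarrow> \<not> adj G b y" "adj G b y" "\<not> adj G b z"
      using sep b by (simp_all add: insert_commute)
    then have xz: "preserves_traces W (transpose x z)"
      using preserves_traces_transpose_aux[OF W xy(1) z(1) b(1)] by blast
    obtain b where b: "b \<in> M'" "adj G x b" "\<not> adj G z b"
      using ex_separating[OF mem(1,3)] z by blast
    have "adj G b x \<longleftrightarrow> \<not> adj G b y" "adj G b x" "\<not> adj G b z"
      using sep b by (simp_all add: insert_commute)
    then have yz: "preserves_traces W (transpose y z)"
      using preserves_traces_transpose_aux[OF W xy(2) z(1) b(1)] by blast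
    have im: "transpose x z ` W \<subseteq> W" "transpose y z ` W \<subseteq> W"
      using xy z by (auto simp: transpose_def)
    have "transpose x y = transpose x z \<circ> (transpose y z \<circ> transpose x z)"
      using sep z by (auto simp: fun_eq_iff transpose_def)
    moreover have "(transpose y z \<circ> transpose x z) ` W \<subseteq> W"
      using im by (auto simp: image_comp[symmetric])
    ultimately show ?thesis
      using preserves_traces_comp xz yz im(1) by metis
  qed
qed

text \<open>Transpositions generate. The reversed induction applies the new transposition first, so
  only its image of \<open>W\<close> has to be controlled when composing.\<close>

lemma preserves_traces_permutes:
  assumes W: "finite W" "W \<subseteq> M" and p: "p permutes W"
  shows "preserves_traces W p"
  using W(1) p
proof (induction p rule: permutes_rev_induct)
  case id
  then show ?case
    unfolding preserves_traces_def by auto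
next
  case (swap a b p)
  have "transpose a b ` W \<subseteq> W"
    using swap by (auto simp: transpose_def)
  then show ?case
    using preserves_traces_comp preserves_traces_transpose[OF W] swap by blast
qed

section \<open>Extending maps inside one clique\<close>

text \<open>Any \<open>b \<in> M'\<close> will do: with \<open>p\<close> a permutation of
  \<open>S \<union> T\<close> extending \<open>f\<close>, \<open>b'\<close> is a vertex whose trace
  is the image under \<open>p\<close> of the trace of \<open>b\<close>.\<close>

lemma ex_extension_to_M':
  assumes S: "finite S" "S \<subseteq> M" and T: "T \<subseteq> M" and f: "bij_betw f S T"
  obtains b b' where "b \<in> M'" "b' \<in> M'" "\<And>s. s \<in> S \<Longrightarrow> adj G b' (f s) \<longleftrightarrow> adj G b s"
proof -
  obtain p where p: "p permutes S \<union> T" "\<And>x. x \<in> S \<Longrightarrow> p x = f x"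
    using bij_betw_extend_permutes[OF f S(1)] by blast
  have "finite (S \<union> T)"
    using f S(1) bij_betw_finite by blast
  then have "preserves_traces (S \<union> T) p"
    using preserves_traces_permutes p(1) S T by simp
  then show thesis
    using that p(2) M'_nonempty unfolding preserves_traces_def by (metis UnCI ex_in_conv)
qed

text \<open>The auxiliary pair \<open>b, b'\<close> anchors \<open>M'\<close>, and an element of the
  nonempty \<open>S\<close> anchors \<open>M\<close>; hence the extension to \<open>G\<close>
  restricts to the pair of cliques.\<close>

lemma extend_one_sided:
  assumes S: "finite S" "S \<subseteq> M" "S \<noteq> {}" and T: "T \<subseteq> M" and f: "bij_betw f S T"
  obtains g where "automorphism (induced G (M \<union> M')) g" "\<And>s. s \<in> S \<Longrightarrow> g s = f s"
proof -
  obtain b b' where b: "b \<in> M'" "b' \<in> M'" and e: "\<And>s. s \<in> S \<Longrightarrow> adj G b' (f s) \<longleftrightarrow> adj G b s"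
    using ex_extension_to_M'[OF S(1,2) T f] by blast
  have S_color: "s \<in> M" "f s \<in> M" "s \<in> verts G" "f s \<in> verts G" "colr G s = c" "colr G (f s) = c"
    if "s \<in> S" for s
    using that S T f M_color bij_betwE by blast+
  have b_color: "b \<in> verts G" "b' \<in> verts G" "colr G b = c'" "colr G b' = c'"
    using b M'_color by auto
  have inj: "f u = f v \<longleftrightarrow> u = v" if "u \<in> S" "v \<in> S" for u v
    using f that by (auto simp: bij_betw_def inj_on_def)
  have ne: "s \<noteq> b" "f s \<noteq> b'" if "s \<in> S" for s
    using S_color[OF that] b_color colors by auto
  \<comment> \<open>By color \<open>b\<close> is not in \<open>S\<close>, so the update leaves
    \<open>f\<close> unchanged on \<open>S\<close>.\<close>
  define h where "h = f(b := b')"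
  have hS: "h s = f s" if "s \<in> S" for s
    using ne[OF that] by (simp add: h_def)
  have hb: "h b = b'"
    by (simp add: h_def)
  have he: "adj G u v \<longleftrightarrow> adj G (h u) (h v)" if "u \<in> insert b S" "v \<in> insert b S" for u v
  proof (cases "u = b")
    case True
    then show ?thesis
      using that adj_irrefl[OF graph] by (cases "v = b") (simp_all add: hb hS e)
  next
    case False
    then show ?thesis
      using that
      by (cases "v = b")
        (simp_all add: hb hS e M_adj S_color inj adj_commute[where v = b] adj_commute[where v = b'])
  qed
  have hi: "inj_on h (insert b S)"
    using inj ne by (auto simp: inj_on_def hb hS)
  have hs: "insert b S \<subseteq> verts G" "h ` insert b S \<subseteq> verts G"
    using S_color b_color by (auto simp: hb hS)
  have hc: "colr G (h u) = colr G u" if "u \<in> insert b S" for u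
    using that S_color b_color by (auto simp: hb hS)
  obtain g where g: "automorphism G g" "\<And>u. u \<in> insert b S \<Longrightarrow> g u = h u"
    using ultrahomogeneous_extend[OF uh finite.insertI[OF S(1)] hs hi he hc] by blast
  have "g b \<in> M'"
    using g(2) hb b by simp
  then have "g v \<in> M' \<longleftrightarrow> v \<in> M'" if "v \<in> verts G" for v
    using automorphism_M'[OF g(1) b(1)] that by blast
  moreover obtain s where s: "s \<in> S"
    using S(3) by blast
  have "g s \<in> M"
    using g(2) hS s S_color by simp
  then have "g v \<in> M \<longleftrightarrow> v \<in> M" if "v \<in> verts G" for v
    using automorphism_maximal_colored_clique[OF cliques M g(1)] s S_color that by blast
  ultimately have "automorphism (induced G (M \<union> M')) g"
    using automorphism_induced[OF g(1), of "M \<union> M'"] M_color M'_color by blast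
  then show thesis
    using that g(2) hS by simp
qed

end

section \<open>Combining the two cliques\<close>

text \<open>By the symmetry of D, all results on subsets of \<open>M\<close> transfer to subsets of
  \<open>M'\<close>.\<close>

lemma (in D_clique_pair) swapped: "D_clique_pair G c' c M' M"
  by unfold_locales (use graph uh cliques colors M M' D contains_D_commute in auto)

lemma (in D_clique_pair) ultrahomogeneous_pair: "ultrahomogeneous (induced G (M \<union> M'))"
  unfolding ultrahomogeneous_def
proof (intro allI impI, elim conjE)
  let ?H = "induced G (M \<union> M')"
  fix S T f
  assume ST: "S \<subseteq> verts ?H" "T \<subseteq> verts ?H" "finite S" "finite T"
    and f: "cg_iso (induced ?H S) (induced ?H T) f"
  have sub: "S \<subseteq> M \<union> M'" "T \<subseteq> M \<union> M'" "S \<subseteq> verts G" "T \<subseteq> verts G"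
    using ST by auto
  then have "verts G \<inter> (M \<union> M') \<inter> S = S" "verts G \<inter> (M \<union> M') \<inter> T = T"
    by auto
  then have bij: "bij_betw f S T"
    and col: "\<And>u. u \<in> S \<Longrightarrow> colr G (f u) = colr G u"
    and e: "\<And>u v. u \<in> S \<Longrightarrow> v \<in> S \<Longrightarrow> adj ?H u v \<longleftrightarrow> adj ?H (f u) (f v)"
    using f by (auto simp: cg_iso_def bij_betw_def)
  have fT: "f u \<in> T" if "u \<in> S" for u
    using bij that bij_betwE by blast
  have col_iff: "x \<in> M \<longleftrightarrow> colr G x = c" "x \<in> M' \<longleftrightarrow> colr G x = c'" if "x \<in> M \<union> M'" for x
    using that M_color M'_color colors by auto
  \<comment> \<open>Within \<open>M \<union> M'\<close> the color of a vertex tells which clique it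
    belongs to, and \<open>f\<close> preserves colors.\<close>
  have fM: "f u \<in> M \<longleftrightarrow> u \<in> M" "f u \<in> M' \<longleftrightarrow> u \<in> M'" if "u \<in> S" for u
    using col_iff col fT sub that by (metis subsetD)+
  have T: "T = f ` S"
    using bij by (simp add: bij_betw_def)
  consider "S = {}" | "S \<noteq> {}" "S \<subseteq> M" | "S \<noteq> {}" "S \<subseteq> M'"
    | s s' where "s \<in> S" "s \<in> M" "s' \<in> S" "s' \<in> M'"
    using sub(1) by blast
  then show "\<exists>g. automorphism ?H g \<and> (\<forall>u\<in>S. g u = f u)"
  proof cases
    case 1
    have "automorphism ?H id"
      by (simp add: cg_iso_def)
    then show ?thesis
      using 1 by blast
  next
    case 2
    then have "T \<subseteq> M"
      using fM T by blast
    then show ?thesis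
      using extend_one_sided[OF ST(3) 2(2,1) _ bij] by metis
  next
    case 3
    then have "T \<subseteq> M'"
      using fM T by blast
    then show ?thesis
      using D_clique_pair.extend_one_sided[OF swapped ST(3) 3(2,1) _ bij] by (metis Un_commute)
  next
    case 4
    \<comment> \<open>Here \<open>s\<close> and \<open>s'\<close> already anchor both cliques, so
      \<open>f\<close> is extended directly, without an auxiliary vertex.\<close>
    have fe: "adj G u v \<longleftrightarrow> adj G (f u) (f v)" if "u \<in> S" "v \<in> S" for u v
      using e[OF that] that fT sub by auto
    have fs: "f ` S \<subseteq> verts G" "inj_on f S"
      using bij sub by (auto simp: bij_betw_def)
    obtain g where g: "automorphism G g" "\<And>u. u \<in> S \<Longrightarrow> g u = f u"
      using ultrahomogeneous_extend[OF uh ST(3) sub(3) fs fe col] by blast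
    have "g s \<in> M" "g s' \<in> M'"
      using 4 g(2) fM by auto
    then have "g v \<in> M \<union> M' \<longleftrightarrow> v \<in> M \<union> M'" if "v \<in> verts G" for v
      using automorphism_maximal_colored_clique[OF cliques M g(1), of s v]
        automorphism_M'[OF g(1), of s' v] 4 that
      by blast
    then have "automorphism ?H g"
      using automorphism_induced[OF g(1), of "M \<union> M'"] M_color M'_color by blast
    then show ?thesis
      using g(2) by blast
  qed
qed

theorem theorem4p1:
  fixes G :: "'a cgraph"
  assumes "basic_CUH G"
    and "realized D_graph G"
    and "realized D_tilde_graph G"
  shows "piecewise_ultrahomogeneous G"
  unfolding piecewise_ultrahomogeneous_def
proof (intro allI impI)
  fix M\<^sub>R M\<^sub>B
  assume "maximal_colored_clique G Red M\<^sub>R \<and> maximal_colored_clique G Blue M\<^sub>B"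
  \<comment> \<open>The copy of D may lie anywhere in \<open>G\<close>; ultrahomogeneity transports
    it to the given cliques.\<close>
  then interpret D_clique_pair G Red Blue M\<^sub>R M\<^sub>B
    using assms realized_D_contains_D
    by unfold_locales (auto simp: basic_CUH_def CUH_def)
  show "ultrahomogeneous (induced G (M\<^sub>R \<union> M\<^sub>B))"
    by (rule ultrahomogeneous_pair)
qed

end
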